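(* Let $X$ be a set of the cardinality of the continuum, let $(G,\odot,\rho)$ be a Polish group, and let $f:G\to X$ be a bijection. For $x,y\in X$ set $$x\odot_f y=f\bigl(f^{-1}(x)\odot f^{-1}(y)\bigr),\qquad \rho_f(x,y)=\rho\bigl(f^{-1}(x),f^{-1}(y)\bigr),$$ and write $G_f=X$. Let $\mathcal{B}_{\rho_f}(G_f)$ be the Borel $\sigma$-algebra of $G_f$ generated by the metric $\rho_f$, and for a Borel measure $\lambda$ on $(G,\rho)$ let $\lambda_f$ be the Borel measure on $(G_f,\rho_f)$ defined by $\lambda_f(Y)=\lambda(f^{-1}(Y))$ for $Y\in\mathcal{B}_{\rho_f}(G_f)$. Then the following hold. (i) $(G_f,\odot_f,\rho_f)$ is a Polish group which is Borel isomorphic to the Polish group $(G,\odot,\rho)$. (ii) If $(G,\odot,\rho)$ is an abelian Polish group, then so is $(G_f,\odot_f,\rho_f)$. (iii) If $\rho$ is a two-sided invariant metric in $(G,\odot)$, then $\rho_f$ is a two-sided invariant metric in $(G_f,\odot_f)$. (iv) If $(G,\odot,\rho)$ is dense-in-itself, then so is $(G_f,\odot_f,\rho_f)$. (v) If $(G,\odot,\rho)$ is a compact Polish group, then so is $(G_f,\odot_f,\rho_f)$. (vi) If $(G,\odot,\rho)$ is a locally compact Polish group, then so is $(G_f,\odot_f,\rho_f)$. (vii) If $(G,\odot,\rho)$ is a non-locally compact Polish group, then so is $(G_f,\odot_f,\rho_f)$. (viii) If $(G,\odot,\rho)$ is a locally compact or compact Polish group and $\lambda$ is a left (respectively right, respectively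 two-sided) invariant Haar measure in $(G,\odot,\rho)$, then $\lambda_f$ is a left (respectively right, respectively two-sided) invariant Haar measure in $(G_f,\odot_f,\rho_f)$. (ix) If $(G,\odot,\rho)$ is a non-locally compact Polish group and $\lambda$ is a left (respectively right, respectively two-sided) invariant quasi-finite Borel measure in $(G,\odot,\rho)$, then $\lambda_f$ is a left (respectively right, respectively two-sided) invariant quasi-finite Borel measure in $(G_f,\odot_f,\rho_f)$.
   Context: A Polish group $(G,\odot,\rho)$ is a group $(G,\odot)$ with a complete separable metric $\rho$ such that the map $G\times G\to G$, $(x,y)\mapsto x^{-1}\odot y$, is continuous. Topological properties (compact, locally compact, etc.) refer to the metric topology. A space is dense-in-itself if it has no isolated points. Two metric spaces are Borel isomorphic if there is a bijection between them that is Borel measurable and has Borel measurable inverse (Borel $\sigma$-algebras being generated by the given metrics). A metric $\rho$ on a group $(G,\odot)$ is two-sided invariant if $\rho(h_1\odot x\odot h_2,h_1\odot y\odot h_2)=\rho(x,y)$ for all $x,y,h_1,h_2\in G$. A Borel measure $\mu$ on a Polish group is left invariant if $\mu(g\odot E)=\mu(E)$, right invariant if $\mu(E\odot g)=\mu(E)$, and two-sided invariant if $\mu(g_1\odot E\odot g_2)=\mu(E)$, for all group elements $g,g_1,g_2$ and all Borel sets $E$. A left (right, two-sided) invariant Haar measure in a locally compact Polish group is a Borel measure $\mu$ that is: diffused (vanishes on all singletons); left (right, two-sided) invariant; outer regular ($\mu(E)=\inf\{\mu(U):E\subseteq U,\ U\text{ open}\}$ for every Borel $E$); inner regular ($\mu(E)=\sup\{\mu(F):F\subseteq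 E,\ F\text{ compact}\}$ for every Borel $E$); and finite on every compact set. A measure $\mu$ is quasi-finite if there is a $\mu$-measurable set $A$ with $0<\mu(A)<+\infty$. *)

theory Defs
  imports "HOL-Analysis.Analysis" "HOL-Algebra.Coset"
begin

section \<open>Topological and Borel notions\<close>

definition borel_of :: "'a topology \<Rightarrow> 'a measure" where
  "borel_of T = sigma (topspace T) {U. openin T U}"

definition borel_isomorphic :: "'a topology \<Rightarrow> 'b topology \<Rightarrow> bool" where
  "borel_isomorphic S T \<longleftrightarrow>
     (\<exists>h. bij_betw h (topspace S) (topspace T) \<and>
          h \<in> borel_of S \<rightarrow>\<^sub>M borel_of T \<and>
          inv_into (topspace S) h \<in> borel_of T \<rightarrow>\<^sub>M borel_of S)"

definition dense_in_itself :: "'a topology \<Rightarrow> bool" where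
  "dense_in_itself T \<longleftrightarrow> \<not> (\<exists>x\<in>topspace T. openin T {x})"

section \<open>Polish groups\<close>

abbreviation group_topology :: "('a, 'm) monoid_scheme \<Rightarrow> ('a \<Rightarrow> 'a \<Rightarrow> real) \<Rightarrow> 'a topology" where
  "group_topology G \<rho> \<equiv> Metric_space.mtopology (carrier G) \<rho>"

definition polish_group :: "('a, 'm) monoid_scheme \<Rightarrow> ('a \<Rightarrow> 'a \<Rightarrow> real) \<Rightarrow> bool" where
  "polish_group G \<rho> \<longleftrightarrow>
     group G \<and>
     Metric_space (carrier G) \<rho> \<and>
     Metric_space.mcomplete (carrier G) \<rho> \<and>
     separable_space (group_topology G \<rho>) \<and>
     continuous_map (prod_topology (group_topology G \<rho>) (group_topology G \<rho>)) (group_topology G \<rho>)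
       (\<lambda>(x, y). inv\<^bsub>G\<^esub> x \<otimes>\<^bsub>G\<^esub> y)"

definition two_sided_invariant_metric ::
    "('a, 'm) monoid_scheme \<Rightarrow> ('a \<Rightarrow> 'a \<Rightarrow> real) \<Rightarrow> bool" where
  "two_sided_invariant_metric G \<rho> \<longleftrightarrow>
     Metric_space (carrier G) \<rho> \<and>
     (\<forall>x\<in>carrier G. \<forall>y\<in>carrier G. \<forall>h1\<in>carrier G. \<forall>h2\<in>carrier G.
        \<rho> (h1 \<otimes>\<^bsub>G\<^esub> x \<otimes>\<^bsub>G\<^esub> h2) (h1 \<otimes>\<^bsub>G\<^esub> y \<otimes>\<^bsub>G\<^esub> h2) = \<rho> x y)"

section \<open>Invariant measures\<close>

definition borel_measure_on :: "'a topology \<Rightarrow> 'a measure \<Rightarrow> bool" where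
  "borel_measure_on T \<mu> \<longleftrightarrow> sets \<mu> = sets (borel_of T)"

definition left_invariant :: "('a, 'm) monoid_scheme \<Rightarrow> 'a measure \<Rightarrow> bool" where
  "left_invariant G \<mu> \<longleftrightarrow>
     (\<forall>g\<in>carrier G. \<forall>E\<in>sets \<mu>. emeasure \<mu> (g <#\<^bsub>G\<^esub> E) = emeasure \<mu> E)"

definition right_invariant :: "('a, 'm) monoid_scheme \<Rightarrow> 'a measure \<Rightarrow> bool" where
  "right_invariant G \<mu> \<longleftrightarrow>
     (\<forall>g\<in>carrier G. \<forall>E\<in>sets \<mu>. emeasure \<mu> (E #>\<^bsub>G\<^esub> g) = emeasure \<mu> E)"

definition two_sided_invariant :: "('a, 'm) monoid_scheme \<Rightarrow> 'a measure \<Rightarrow> bool" where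
  "two_sided_invariant G \<mu> \<longleftrightarrow>
     (\<forall>g1\<in>carrier G. \<forall>g2\<in>carrier G. \<forall>E\<in>sets \<mu>.
        emeasure \<mu> ((g1 <#\<^bsub>G\<^esub> E) #>\<^bsub>G\<^esub> g2) = emeasure \<mu> E)"

definition diffused :: "'a measure \<Rightarrow> bool" where
  "diffused \<mu> \<longleftrightarrow> (\<forall>x\<in>space \<mu>. emeasure \<mu> {x} = 0)"

definition outer_regular_on :: "'a topology \<Rightarrow> 'a measure \<Rightarrow> bool" where
  "outer_regular_on T \<mu> \<longleftrightarrow>
     (\<forall>E\<in>sets \<mu>. emeasure \<mu> E = (INF U\<in>{U. E \<subseteq> U \<and> openin T U}. emeasure \<mu> U))"

definition inner_regular_on :: "'a topology \<Rightarrow> 'a measure \<Rightarrow> bool" where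
  "inner_regular_on T \<mu> \<longleftrightarrow>
     (\<forall>E\<in>sets \<mu>. emeasure \<mu> E = (SUP F\<in>{F. F \<subseteq> E \<and> compactin T F}. emeasure \<mu> F))"

definition finite_on_compacts :: "'a topology \<Rightarrow> 'a measure \<Rightarrow> bool" where
  "finite_on_compacts T \<mu> \<longleftrightarrow> (\<forall>K. compactin T K \<longrightarrow> emeasure \<mu> K < \<infinity>)"

definition quasi_finite :: "'a measure \<Rightarrow> bool" where
  "quasi_finite \<mu> \<longleftrightarrow> (\<exists>A\<in>sets \<mu>. 0 < emeasure \<mu> A \<and> emeasure \<mu> A < \<infinity>)"

text \<open>
  The part of the definition of a Haar measure that does not mention the group operation.
  The zero measure is not excluded, and a Haar measure is required to be diffused, so that
  a nonzero one can exist only on a non-discrete group.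
\<close>

definition haar_regular :: "'a topology \<Rightarrow> 'a measure \<Rightarrow> bool" where
  "haar_regular T \<mu> \<longleftrightarrow>
     borel_measure_on T \<mu> \<and> diffused \<mu> \<and> outer_regular_on T \<mu> \<and> inner_regular_on T \<mu> \<and>
     finite_on_compacts T \<mu>"

definition left_haar_measure ::
    "('a, 'm) monoid_scheme \<Rightarrow> ('a \<Rightarrow> 'a \<Rightarrow> real) \<Rightarrow> 'a measure \<Rightarrow> bool" where
  "left_haar_measure G \<rho> \<mu> \<longleftrightarrow> haar_regular (group_topology G \<rho>) \<mu> \<and> left_invariant G \<mu>"

definition right_haar_measure ::
    "('a, 'm) monoid_scheme \<Rightarrow> ('a \<Rightarrow> 'a \<Rightarrow> real) \<Rightarrow> 'a measure \<Rightarrow> bool" where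
  "right_haar_measure G \<rho> \<mu> \<longleftrightarrow> haar_regular (group_topology G \<rho>) \<mu> \<and> right_invariant G \<mu>"

definition two_sided_haar_measure ::
    "('a, 'm) monoid_scheme \<Rightarrow> ('a \<Rightarrow> 'a \<Rightarrow> real) \<Rightarrow> 'a measure \<Rightarrow> bool" where
  "two_sided_haar_measure G \<rho> \<mu> \<longleftrightarrow>
     haar_regular (group_topology G \<rho>) \<mu> \<and> two_sided_invariant G \<mu>"

section \<open>Transport along a bijection\<close>

text \<open>
  The maps below are meant for a bijection \<open>f\<close> from \<open>carrier G\<close> onto \<open>X\<close>, for which
  \<open>inv_into (carrier G) f\<close> is the inverse of \<open>f\<close> on \<open>X\<close>. The record type also asks for the
  identity element, which for a group operation is determined by the operation.
\<close>

definition transport_group :: "('a, 'm) monoid_scheme \<Rightarrow> ('a \<Rightarrow> 'b) \<Rightarrow> 'b set \<Rightarrow> 'b monoid" where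
  "transport_group G f X =
     \<lparr>carrier = X,
      mult = (\<lambda>x y. f (inv_into (carrier G) f x \<otimes>\<^bsub>G\<^esub> inv_into (carrier G) f y)),
      one = f \<one>\<^bsub>G\<^esub>\<rparr>"

definition transport_metric ::
    "('a, 'm) monoid_scheme \<Rightarrow> ('a \<Rightarrow> 'a \<Rightarrow> real) \<Rightarrow> ('a \<Rightarrow> 'b) \<Rightarrow> 'b \<Rightarrow> 'b \<Rightarrow> real" where
  "transport_metric G \<rho> f = (\<lambda>x y. \<rho> (inv_into (carrier G) f x) (inv_into (carrier G) f y))"

text \<open>
  The push-forward of a measure \<open>\<mu>\<close> on \<open>carrier G\<close>: a Borel set \<open>Y\<close> of \<open>X\<close> has measure
  \<open>emeasure \<mu> (f -` Y \<inter> space \<mu>)\<close>.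
\<close>

definition transport_measure ::
    "('a, 'm) monoid_scheme \<Rightarrow> ('a \<Rightarrow> 'a \<Rightarrow> real) \<Rightarrow> ('a \<Rightarrow> 'b) \<Rightarrow> 'b set \<Rightarrow> 'a measure \<Rightarrow> 'b measure" where
  "transport_measure G \<rho> f X \<mu> =
     distr \<mu> (borel_of (group_topology (transport_group G f X) (transport_metric G \<rho> f))) f"

end

theory Submission
  imports Defs
begin

text \<open>
  Every notion in the theorem is formulated in terms of the group operation, the metric, the
  topology or the Borel measure of \<open>G\<close>, and the bijection \<open>f\<close> preserves all of them: the
  operation and the metric on \<open>X\<close> are defined so that \<open>f\<close> is at once a group isomorphism and an
  isometry, hence also a homeomorphism of the metric topologies. The theorem is therefore a
  collection of invariance principles, proved here for an arbitrary isomorphism, isometry or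
  homeomorphism rather than for the transported structure.

  The part that takes some work concerns measures. A homeomorphism \<open>f\<close> from \<open>S\<close> to \<open>T\<close> maps the
  Borel sets of \<open>S\<close> bijectively onto those of \<open>T\<close>, and the push-forward \<open>\<nu>\<close> of a Borel measure
  \<open>\<mu>\<close> satisfies \<open>\<nu> (f ` A) = \<mu> A\<close> for every subset \<open>A\<close> of \<open>S\<close> (\<open>emeasure_pushforward_image\<close>).
  Since open sets, compact sets and singletons of \<open>T\<close> are the images of those of \<open>S\<close>, this one
  formula turns each regularity condition on \<open>\<nu>\<close> into the same condition on \<open>\<mu>\<close>. If \<open>f\<close> is a
  homomorphism as well, it maps translates to translates, and the formula turns invariance of
  \<open>\<mu>\<close> into invariance of \<open>\<nu>\<close>.
\<close>

section \<open>Homeomorphisms and Borel sets\<close>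

lemma space_borel_of: "space (borel_of T) = topspace T"
  unfolding borel_of_def by (rule space_measure_of) (auto dest: openin_subset)

lemma continuous_map_measurable_borel_of:
  assumes "continuous_map S T f"
  shows "f \<in> borel_of S \<rightarrow>\<^sub>M borel_of T"
  unfolding borel_of_def[of T]
proof (rule measurable_measure_of)
  show "{U. openin T U} \<subseteq> Pow (topspace T)"
    by (auto dest: openin_subset)
  show "f \<in> space (borel_of S) \<rightarrow> topspace T"
    using assms by (simp add: space_borel_of continuous_map_funspace)
next
  fix U assume "U \<in> {U. openin T U}"
  then have "openin S {x \<in> topspace S. f x \<in> U}"
    using assms openin_continuous_map_preimage by blast
  moreover have "f -` U \<inter> space (borel_of S) = {x \<in> topspace S. f x \<in> U}"
    by (auto simp: space_borel_of)
  moreover have "{U. openin S U} \<subseteq> Pow (topspace S)"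
    by (auto dest: openin_subset)
  ultimately show "f -` U \<inter> space (borel_of S) \<in> sets (borel_of S)"
    by (simp add: borel_of_def sigma_sets.Basic)
qed

lemma homeomorphic_map_inv_into:
  assumes "homeomorphic_map S T f"
  shows "homeomorphic_maps S T f (inv_into (topspace S) f)"
proof -
  obtain g where g: "homeomorphic_maps S T f g"
    using assms by (auto simp: homeomorphic_map_maps)
  have bij: "inj_on f (topspace S)" "f ` topspace S = topspace T"
    using assms by (auto simp: homeomorphic_eq_everything_map)
  have "inv_into (topspace S) f y = g y" if "y \<in> topspace T" for y
    using that g inv_into_f_eq[OF bij(1), of "g y" y]
    by (auto simp: homeomorphic_maps_def continuous_map_def)
  then show ?thesis
    by (intro homeomorphic_maps_eq[OF g]) simp_all
qed

lemma homeomorphic_space_imp_borel_isomorphic: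
  assumes "S homeomorphic_space T"
  shows "borel_isomorphic S T"
proof -
  obtain f where f: "homeomorphic_map S T f"
    using assms homeomorphic_space by blast
  have "bij_betw f (topspace S) (topspace T)"
    using f by (auto simp: homeomorphic_eq_everything_map bij_betw_def)
  moreover have "f \<in> borel_of S \<rightarrow>\<^sub>M borel_of T"
    "inv_into (topspace S) f \<in> borel_of T \<rightarrow>\<^sub>M borel_of S"
    using homeomorphic_map_inv_into[OF f]
    by (auto simp: homeomorphic_maps_def intro: continuous_map_measurable_borel_of)
  ultimately show ?thesis
    unfolding borel_isomorphic_def by blast
qed

lemma homeomorphic_map_openin_iff_image:
  assumes "homeomorphic_map S T f"
  shows "openin T V \<longleftrightarrow> (\<exists>U. openin S U \<and> V = f ` U)"
proof
  assume V: "openin T V"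
  then have "V \<subseteq> f ` topspace S"
    using assms homeomorphic_imp_surjective_map openin_subset by metis
  then obtain U where "U \<subseteq> topspace S" "V = f ` U"
    by (auto simp: subset_image_iff)
  then show "\<exists>U. openin S U \<and> V = f ` U"
    using V homeomorphic_map_openness_eq[OF assms] by blast
qed (use homeomorphic_map_openness_eq[OF assms] in blast)

lemma homeomorphic_map_compactin_iff_image:
  assumes "homeomorphic_map S T f"
  shows "compactin T L \<longleftrightarrow> (\<exists>K. compactin S K \<and> L = f ` K)"
proof
  assume L: "compactin T L"
  then have "L \<subseteq> f ` topspace S"
    using assms homeomorphic_imp_surjective_map compactin_subset_topspace by metis
  then obtain K where "K \<subseteq> topspace S" "L = f ` K"
    by (auto simp: subset_image_iff)
  then show "\<exists>K. compactin S K \<and> L = f ` K"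
    using L homeomorphic_map_compactness_eq[OF assms] by blast
qed (use homeomorphic_map_compactness_eq[OF assms] in blast)

lemma homeomorphic_map_dense_in_itself:
  assumes f: "homeomorphic_map S T f" and S: "dense_in_itself S"
  shows "dense_in_itself T"
  unfolding dense_in_itself_def
proof (intro notI, elim bexE)
  fix y assume y: "y \<in> topspace T" "openin T {y}"
  then obtain x where x: "x \<in> topspace S" "y = f x"
    using homeomorphic_imp_surjective_map[OF f] by auto
  with y have "openin S {x}"
    using homeomorphic_map_openness_eq[OF f, of "{x}"] by simp
  with x S show False
    by (auto simp: dense_in_itself_def)
qed

section \<open>Push-forward of a Borel measure along a homeomorphism\<close>

locale homeomorphic_pushforward =
  fixes S :: "'a topology" and T :: "'b topology" and f :: "'a \<Rightarrow> 'b"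
    and \<mu> :: "'a measure"
  assumes homeo: "homeomorphic_map S T f"
    and borel: "borel_measure_on S \<mu>"
begin

abbreviation pushforward :: "'b measure" where
  "pushforward \<equiv> distr \<mu> (borel_of T) f"

lemma space_source: "space \<mu> = topspace S"
  using borel sets_eq_imp_space_eq[of \<mu> "borel_of S"]
  by (simp add: borel_measure_on_def space_borel_of)

lemma inj: "inj_on f (topspace S)" and surj: "f ` topspace S = topspace T"
  using homeo by (auto simp: homeomorphic_eq_everything_map)

lemma borel_measure_on_pushforward: "borel_measure_on T pushforward"
  by (simp add: borel_measure_on_def)

lemma measurable_f: "f \<in> \<mu> \<rightarrow>\<^sub>M borel_of T"
  using continuous_map_measurable_borel_of[OF homeomorphic_imp_continuous_map[OF homeo]] borel
  by (simp add: borel_measure_on_def cong: measurable_cong_sets)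

lemma vimage_image: "A \<subseteq> topspace S \<Longrightarrow> f -` (f ` A) \<inter> topspace S = A"
  using inj by (auto dest: inj_onD)

lemma image_in_sets_iff:
  assumes A: "A \<subseteq> topspace S"
  shows "f ` A \<in> sets pushforward \<longleftrightarrow> A \<in> sets \<mu>"
proof
  assume "f ` A \<in> sets pushforward"
  then have "f -` (f ` A) \<inter> space \<mu> \<in> sets \<mu>"
    using measurable_f by (simp add: measurable_sets)
  then show "A \<in> sets \<mu>"
    using A by (simp add: space_source vimage_image)
next
  let ?g = "inv_into (topspace S) f"
  assume "A \<in> sets \<mu>"
  then have "A \<in> sets (borel_of S)"
    using borel by (simp add: borel_measure_on_def)
  moreover have "?g \<in> borel_of T \<rightarrow>\<^sub>M borel_of S"
    using homeomorphic_map_inv_into[OF homeo]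
    by (auto simp: homeomorphic_maps_def intro: continuous_map_measurable_borel_of)
  ultimately have "?g -` A \<inter> topspace T \<in> sets (borel_of T)"
    using measurable_sets space_borel_of by metis
  moreover have "?g -` A \<inter> topspace T = f ` A"
    using A inj surj[symmetric] by (auto simp: image_iff subset_iff)
  ultimately show "f ` A \<in> sets pushforward"
    by simp
qed

lemma sets_pushforwardE:
  assumes "E \<in> sets pushforward"
  obtains A where "A \<in> sets \<mu>" "A \<subseteq> topspace S" "E = f ` A"
proof -
  have "E \<subseteq> f ` topspace S"
    using sets.sets_into_space[OF assms] by (simp add: space_borel_of surj)
  then obtain A where "A \<subseteq> topspace S" "E = f ` A"
    by (auto simp: subset_image_iff)
  then show thesis
    using that assms image_in_sets_iff by blast
qed

text \<open>
  The formula holds for non-measurable \<open>A\<close> too, because then \<open>f ` A\<close> is not measurable either and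
  both sides have the default value 0. In this form it applies directly to translates, open sets
  and compact sets.
\<close>

lemma emeasure_pushforward_image:
  assumes A: "A \<subseteq> topspace S"
  shows "emeasure pushforward (f ` A) = emeasure \<mu> A"
proof (cases "A \<in> sets \<mu>")
  case True
  then have "f ` A \<in> sets (borel_of T)"
    using image_in_sets_iff[OF A] by simp
  then show ?thesis
    using A by (simp add: emeasure_distr[OF measurable_f] space_source vimage_image)
next
  case False
  then show ?thesis
    using image_in_sets_iff[OF A] by (simp add: emeasure_notin_sets)
qed

lemma diffused_pushforward:
  assumes "diffused \<mu>"
  shows "diffused pushforward"
  unfolding diffused_def
proof
  fix y assume "y \<in> space pushforward"
  then obtain x where x: "x \<in> topspace S" "y = f x"
    using surj by (auto simp: space_borel_of)
  then have "emeasure pushforward {y} = emeasure \<mu> {x}"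
    using emeasure_pushforward_image[of "{x}"] by simp
  then show "emeasure pushforward {y} = 0"
    using assms x by (simp add: diffused_def space_source)
qed

lemma outer_regular_on_pushforward:
  assumes "outer_regular_on S \<mu>"
  shows "outer_regular_on T pushforward"
  unfolding outer_regular_on_def
proof
  fix E assume "E \<in> sets pushforward"
  then obtain A where A: "A \<in> sets \<mu>" "A \<subseteq> topspace S" "E = f ` A"
    by (rule sets_pushforwardE)
  have sub: "f ` A \<subseteq> f ` U \<longleftrightarrow> A \<subseteq> U" if "openin S U" for U
    using inj_on_image_subset_iff[OF inj A(2) openin_subset[OF that]] .
  have opens: "{V. E \<subseteq> V \<and> openin T V} = (`) f ` {U. A \<subseteq> U \<and> openin S U}"
    using sub unfolding A(3) homeomorphic_map_openin_iff_image[OF homeo] by blast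
  have "emeasure pushforward E = (INF U\<in>{U. A \<subseteq> U \<and> openin S U}. emeasure \<mu> U)"
    using assms A by (simp add: emeasure_pushforward_image outer_regular_on_def)
  also have "\<dots> = (INF U\<in>{U. A \<subseteq> U \<and> openin S U}. emeasure pushforward (f ` U))"
    by (rule INF_cong) (auto simp: emeasure_pushforward_image dest: openin_subset)
  also have "\<dots> = (INF V\<in>{V. E \<subseteq> V \<and> openin T V}. emeasure pushforward V)"
    unfolding opens by (simp add: image_image)
  finally show "emeasure pushforward E
      = (INF V\<in>{V. E \<subseteq> V \<and> openin T V}. emeasure pushforward V)" .
qed

lemma inner_regular_on_pushforward:
  assumes "inner_regular_on S \<mu>"
  shows "inner_regular_on T pushforward"
  unfolding inner_regular_on_def
proof
  fix E assume "E \<in> sets pushforward"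
  then obtain A where A: "A \<in> sets \<mu>" "A \<subseteq> topspace S" "E = f ` A"
    by (rule sets_pushforwardE)
  have sub: "f ` K \<subseteq> f ` A \<longleftrightarrow> K \<subseteq> A" if "compactin S K" for K
    using inj_on_image_subset_iff[OF inj compactin_subset_topspace[OF that] A(2)] .
  have compacts: "{L. L \<subseteq> E \<and> compactin T L} = (`) f ` {K. K \<subseteq> A \<and> compactin S K}"
    using sub unfolding A(3) homeomorphic_map_compactin_iff_image[OF homeo] by blast
  have "emeasure pushforward E = (SUP K\<in>{K. K \<subseteq> A \<and> compactin S K}. emeasure \<mu> K)"
    using assms A by (simp add: emeasure_pushforward_image inner_regular_on_def)
  also have "\<dots> = (SUP K\<in>{K. K \<subseteq> A \<and> compactin S K}. emeasure pushforward (f ` K))"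
    by (rule SUP_cong) (auto simp: emeasure_pushforward_image dest: compactin_subset_topspace)
  also have "\<dots> = (SUP L\<in>{L. L \<subseteq> E \<and> compactin T L}. emeasure pushforward L)"
    unfolding compacts by (simp add: image_image)
  finally show "emeasure pushforward E
      = (SUP L\<in>{L. L \<subseteq> E \<and> compactin T L}. emeasure pushforward L)" .
qed

lemma finite_on_compacts_pushforward:
  assumes "finite_on_compacts S \<mu>"
  shows "finite_on_compacts T pushforward"
  using assms compactin_subset_topspace emeasure_pushforward_image
  unfolding finite_on_compacts_def homeomorphic_map_compactin_iff_image[OF homeo] by metis

lemma haar_regular_pushforward:
  assumes "haar_regular S \<mu>"
  shows "haar_regular T pushforward"
  using assms unfolding haar_regular_def
  by (blast intro: borel_measure_on_pushforward diffused_pushforward outer_regular_on_pushforward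
      inner_regular_on_pushforward finite_on_compacts_pushforward)

lemma quasi_finite_pushforward:
  assumes "quasi_finite \<mu>"
  shows "quasi_finite pushforward"
proof -
  obtain A where A: "A \<in> sets \<mu>" "0 < emeasure \<mu> A" "emeasure \<mu> A < \<infinity>"
    using assms by (auto simp: quasi_finite_def)
  then have "A \<subseteq> topspace S"
    using sets.sets_into_space space_source by metis
  then show ?thesis
    unfolding quasi_finite_def using A image_in_sets_iff emeasure_pushforward_image
    by (intro bexI[of _ "f ` A"]) simp_all
qed

end

section \<open>Push-forward of an invariant measure\<close>

text \<open>
  These identities together with \<open>emeasure_pushforward_image\<close> reduce the measure of a translate in
  \<open>H\<close> to the measure of a translate in \<open>G\<close>.
\<close>

lemma hom_image_l_coset:
  assumes "f \<in> hom G H" "g \<in> carrier G" "A \<subseteq> carrier G"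
  shows "f ` (g <#\<^bsub>G\<^esub> A) = f g <#\<^bsub>H\<^esub> (f ` A)"
  using assms by (auto simp: l_coset_def hom_mult subset_iff image_UN)

lemma hom_image_r_coset:
  assumes "f \<in> hom G H" "g \<in> carrier G" "A \<subseteq> carrier G"
  shows "f ` (A #>\<^bsub>G\<^esub> g) = (f ` A) #>\<^bsub>H\<^esub> f g"
  using assms by (auto simp: r_coset_def hom_mult subset_iff image_UN)

locale group_pushforward = homeomorphic_pushforward S T f \<mu> + group G
  for G :: "('a, 'm) monoid_scheme" and H :: "('b, 'n) monoid_scheme"
    and S :: "'a topology" and T :: "'b topology" and f :: "'a \<Rightarrow> 'b" and \<mu> :: "'a measure" +
  assumes iso: "f \<in> iso G H"
    and topspace_source: "topspace S = carrier G"
begin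

lemma hom_f: "f \<in> hom G H" and carrier_image: "f ` carrier G = carrier H"
  using iso by (auto simp: iso_iff)

lemma left_invariant_pushforward:
  assumes "left_invariant G \<mu>"
  shows "left_invariant H pushforward"
  unfolding left_invariant_def
proof (intro ballI)
  fix h E assume "h \<in> carrier H" and "E \<in> sets pushforward"
  then obtain g A where g: "g \<in> carrier G" "h = f g"
    and A: "A \<in> sets \<mu>" "A \<subseteq> carrier G" "E = f ` A"
    by (elim sets_pushforwardE) (auto simp: carrier_image[symmetric] topspace_source)
  have "emeasure pushforward (h <#\<^bsub>H\<^esub> E) = emeasure \<mu> (g <#\<^bsub>G\<^esub> A)"
    using g A l_coset_subset_G
    by (simp add: hom_image_l_coset[OF hom_f, symmetric] emeasure_pushforward_image topspace_source)
  also have "\<dots> = emeasure pushforward E"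
    using assms g A by (simp add: left_invariant_def emeasure_pushforward_image topspace_source)
  finally show "emeasure pushforward (h <#\<^bsub>H\<^esub> E) = emeasure pushforward E" .
qed

lemma right_invariant_pushforward:
  assumes "right_invariant G \<mu>"
  shows "right_invariant H pushforward"
  unfolding right_invariant_def
proof (intro ballI)
  fix h E assume "h \<in> carrier H" and "E \<in> sets pushforward"
  then obtain g A where g: "g \<in> carrier G" "h = f g"
    and A: "A \<in> sets \<mu>" "A \<subseteq> carrier G" "E = f ` A"
    by (elim sets_pushforwardE) (auto simp: carrier_image[symmetric] topspace_source)
  have "emeasure pushforward (E #>\<^bsub>H\<^esub> h) = emeasure \<mu> (A #>\<^bsub>G\<^esub> g)"
    using g A r_coset_subset_G
    by (simp add: hom_image_r_coset[OF hom_f, symmetric] emeasure_pushforward_image topspace_source)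
  also have "\<dots> = emeasure pushforward E"
    using assms g A by (simp add: right_invariant_def emeasure_pushforward_image topspace_source)
  finally show "emeasure pushforward (E #>\<^bsub>H\<^esub> h) = emeasure pushforward E" .
qed

lemma two_sided_invariant_pushforward:
  assumes "two_sided_invariant G \<mu>"
  shows "two_sided_invariant H pushforward"
  unfolding two_sided_invariant_def
proof (intro ballI)
  fix h1 h2 E assume "h1 \<in> carrier H" "h2 \<in> carrier H" and "E \<in> sets pushforward"
  then obtain g1 g2 A where g: "g1 \<in> carrier G" "h1 = f g1" "g2 \<in> carrier G" "h2 = f g2"
    and A: "A \<in> sets \<mu>" "A \<subseteq> carrier G" "E = f ` A"
    by (elim sets_pushforwardE) (auto simp: carrier_image[symmetric] topspace_source)
  have "emeasure pushforward ((h1 <#\<^bsub>H\<^esub> E) #>\<^bsub>H\<^esub> h2)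
      = emeasure \<mu> ((g1 <#\<^bsub>G\<^esub> A) #>\<^bsub>G\<^esub> g2)"
    using g A l_coset_subset_G r_coset_subset_G
    by (simp add: hom_image_l_coset[OF hom_f, symmetric] hom_image_r_coset[OF hom_f, symmetric]
        emeasure_pushforward_image topspace_source)
  also have "\<dots> = emeasure pushforward E"
    using assms g A by (simp add: two_sided_invariant_def emeasure_pushforward_image topspace_source)
  finally show "emeasure pushforward ((h1 <#\<^bsub>H\<^esub> E) #>\<^bsub>H\<^esub> h2) = emeasure pushforward E" .
qed

end

section \<open>Isometric isomorphisms\<close>

text \<open>
  The homeomorphism induced by an isometry does not suffice here, since completeness is not a
  topological property: Cauchy sequences are pulled back by the isometry, and only their limits
  are pushed forward by continuity.
\<close>

lemma isometry_mcomplete: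
  assumes "Metric_space M d" "Metric_space N e" and surj: "f ` M = N"
    and isometry: "\<And>x y. x \<in> M \<Longrightarrow> y \<in> M \<Longrightarrow> e (f x) (f y) = d x y"
    and complete: "Metric_space.mcomplete M d"
  shows "Metric_space.mcomplete N e"
proof -
  interpret Metric_space12 M d N e
    using assms by (simp add: Metric_space12_def)
  have f: "homeomorphic_map M1.mtopology M2.mtopology f"
    using surj isometry by (rule isometry_imp_homeomorphic_map)
  let ?g = "inv_into M f"
  show ?thesis
    unfolding M2.mcomplete_def
  proof (intro allI impI)
    fix s assume s: "M2.MCauchy s"
    then have sN: "s n \<in> N" for n
      by (auto simp: M2.MCauchy_def)
    have g: "?g y \<in> M" "f (?g y) = y" if "y \<in> N" for y
      using that surj by (auto simp: inv_into_into f_inv_into_f)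
    have "d (?g y) (?g z) = e y z" if "y \<in> N" "z \<in> N" for y z
      using isometry[of "?g y" "?g z"] g that by simp
    then have "M1.MCauchy (?g \<circ> s)"
      using s g sN by (auto simp: M1.MCauchy_def M2.MCauchy_def)
    then obtain x where "limitin M1.mtopology (?g \<circ> s) x sequentially"
      using complete by (auto simp: M1.mcomplete_def)
    then have "limitin M2.mtopology (f \<circ> (?g \<circ> s)) (f x) sequentially"
      by (rule continuous_map_limit[OF homeomorphic_imp_continuous_map[OF f]])
    moreover have "f \<circ> (?g \<circ> s) = s"
      using g sN by auto
    ultimately show "\<exists>y. limitin M2.mtopology s y sequentially"
      by auto
  qed
qed

locale isometric_group_iso =
  M1: Metric_space "carrier G" \<rho> + M2: Metric_space "carrier H" \<sigma> + G: group G + H: group H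
  for G :: "('a, 'm) monoid_scheme" and \<rho> :: "'a \<Rightarrow> 'a \<Rightarrow> real"
    and H :: "('b, 'n) monoid_scheme" and \<sigma> :: "'b \<Rightarrow> 'b \<Rightarrow> real" and f :: "'a \<Rightarrow> 'b" +
  assumes iso: "f \<in> iso G H"
    and isometry: "\<And>x y. x \<in> carrier G \<Longrightarrow> y \<in> carrier G \<Longrightarrow> \<sigma> (f x) (f y) = \<rho> x y"
begin

sublocale Hom: group_hom G H f
  using iso by unfold_locales (simp add: iso_iff)

lemma carrier_image: "f ` carrier G = carrier H"
  using iso by (auto simp: iso_iff)

lemma homeomorphic_map_group_topology:
  "homeomorphic_map (group_topology G \<rho>) (group_topology H \<sigma>) f"
proof -
  interpret Metric_space12 "carrier G" \<rho> "carrier H" \<sigma> ..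
  show ?thesis
    using carrier_image isometry by (rule isometry_imp_homeomorphic_map)
qed

text \<open>
  The map \<open>(x, y) \<mapsto> x\<inverse> y\<close> of \<open>H\<close> is the one of \<open>G\<close> conjugated by the homeomorphism \<open>f\<close>, hence
  continuous.
\<close>

lemma polish_group_image:
  assumes G: "polish_group G \<rho>"
  shows "polish_group H \<sigma>"
  unfolding polish_group_def
proof (intro conjI)
  let ?S = "group_topology G \<rho>" and ?T = "group_topology H \<sigma>"
  let ?g = "inv_into (carrier G) f"
  let ?q = "\<lambda>(x, y). inv\<^bsub>G\<^esub> x \<otimes>\<^bsub>G\<^esub> y"
  note homeo = homeomorphic_map_group_topology
  have cont_f: "continuous_map ?S ?T f" and cont_g: "continuous_map ?T ?S ?g"
    using homeomorphic_map_inv_into[OF homeo] by (auto simp: homeomorphic_maps_def)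
  show "group H" ..
  show "Metric_space (carrier H) \<sigma>" ..
  show "M2.mcomplete"
    using isometry_mcomplete[OF M1.Metric_space_axioms M2.Metric_space_axioms carrier_image isometry] G
    by (simp add: polish_group_def)
  show "separable_space ?T"
    using G homeo homeomorphic_space homeomorphic_separable_space polish_group_def by blast
  have "continuous_map (prod_topology ?T ?T) (prod_topology ?S ?S) (\<lambda>(x, y). (?g x, ?g y))"
    using cont_g by (simp add: continuous_map_prod_top)
  moreover have "continuous_map (prod_topology ?S ?S) ?S ?q"
    using G by (simp add: polish_group_def)
  ultimately have "continuous_map (prod_topology ?T ?T) ?T (f \<circ> (?q \<circ> (\<lambda>(x, y). (?g x, ?g y))))"
    by (intro continuous_map_compose[OF _ cont_f] continuous_map_compose)
  then show "continuous_map (prod_topology ?T ?T) ?T (\<lambda>(x, y). inv\<^bsub>H\<^esub> x \<otimes>\<^bsub>H\<^esub> y)"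
  proof (rule continuous_map_eq)
    fix p assume "p \<in> topspace (prod_topology ?T ?T)"
    then have "p \<in> f ` carrier G \<times> f ` carrier G"
      by (simp add: carrier_image)
    then obtain x y where "p = (f x, f y)" "x \<in> carrier G" "y \<in> carrier G"
      by auto
    moreover have "inj_on f (carrier G)"
      using iso by (simp add: iso_iff)
    ultimately show "(f \<circ> (?q \<circ> (\<lambda>(x, y). (?g x, ?g y)))) p = (case p of (x, y) \<Rightarrow> inv\<^bsub>H\<^esub> x \<otimes>\<^bsub>H\<^esub> y)"
      by simp
  qed
qed

lemma two_sided_invariant_metric_image:
  assumes "two_sided_invariant_metric G \<rho>"
  shows "two_sided_invariant_metric H \<sigma>"
proof -
  have "\<sigma> (f h1 \<otimes>\<^bsub>H\<^esub> f x \<otimes>\<^bsub>H\<^esub> f h2) (f h1 \<otimes>\<^bsub>H\<^esub> f y \<otimes>\<^bsub>H\<^esub> f h2) = \<sigma> (f x) (f y)"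
    if "x \<in> carrier G" "y \<in> carrier G" "h1 \<in> carrier G" "h2 \<in> carrier G" for x y h1 h2
    using assms that isometry[of "h1 \<otimes>\<^bsub>G\<^esub> x \<otimes>\<^bsub>G\<^esub> h2" "h1 \<otimes>\<^bsub>G\<^esub> y \<otimes>\<^bsub>G\<^esub> h2"] isometry[of x y]
    by (simp add: two_sided_invariant_metric_def)
  then have "\<forall>x\<in>f ` carrier G. \<forall>y\<in>f ` carrier G. \<forall>h1\<in>f ` carrier G. \<forall>h2\<in>f ` carrier G.
      \<sigma> (h1 \<otimes>\<^bsub>H\<^esub> x \<otimes>\<^bsub>H\<^esub> h2) (h1 \<otimes>\<^bsub>H\<^esub> y \<otimes>\<^bsub>H\<^esub> h2) = \<sigma> x y"
    by blast
  then show ?thesis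
    using M2.Metric_space_axioms by (simp add: two_sided_invariant_metric_def carrier_image)
qed

lemma group_pushforward:
  assumes "borel_measure_on (group_topology G \<rho>) \<mu>"
  shows "group_pushforward G H (group_topology G \<rho>) (group_topology H \<sigma>) f \<mu>"
  using assms homeomorphic_map_group_topology iso by unfold_locales simp_all

end

section \<open>The transported group\<close>

context
  fixes G :: "('a, 'm) monoid_scheme" and f :: "'a \<Rightarrow> 'b" and X :: "'b set"
  assumes bij: "bij_betw f (carrier G) X"
begin

text \<open>
  That \<open>f\<close> is an isomorphism is stated before \<open>X\<close> is known to be a group: the group axioms on
  \<open>X\<close> are then inherited along \<open>f\<close>.
\<close>

lemma transport_group_iso:
  assumes "group G"
  shows "f \<in> iso G (transport_group G f X)"
proof -
  interpret group G by fact
  have "inj_on f (carrier G)" "f \<in> carrier G \<rightarrow> X"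
    using bij by (auto simp: bij_betw_def)
  then show ?thesis
    using bij by (auto simp: iso_def hom_def transport_group_def)
qed

lemma group_transport_group:
  assumes "group G"
  shows "group (transport_group G f X)"
  using group.iso_imp_img_group[OF assms transport_group_iso[OF assms]]
  by (simp add: transport_group_def)

lemma comm_group_transport_group:
  assumes "comm_group G"
  shows "comm_group (transport_group G f X)"
  using comm_group.iso_imp_img_comm_group[OF assms transport_group_iso] assms
  by (simp add: transport_group_def comm_group_def)

lemma Metric_space_transport_metric:
  assumes "Metric_space (carrier G) \<rho>"
  shows "Metric_space (carrier (transport_group G f X)) (transport_metric G \<rho> f)"
proof -
  interpret Metric_space "carrier G" \<rho> by fact
  let ?g = "inv_into (carrier G) f"
  have g: "?g x \<in> carrier G" "?g x = ?g y \<longleftrightarrow> x = y" if "x \<in> X" "y \<in> X" for x y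
    using that bij by (auto simp: bij_betw_def inv_into_into dest: inv_into_injective)
  show ?thesis
    by unfold_locales
      (use g triangle in \<open>auto simp: transport_metric_def transport_group_def commute\<close>)
qed

lemma isometric_group_iso_transport:
  assumes "polish_group G \<rho>"
  shows "isometric_group_iso G \<rho> (transport_group G f X) (transport_metric G \<rho> f) f"
proof -
  have G: "group G" "Metric_space (carrier G) \<rho>"
    using assms by (auto simp: polish_group_def)
  have "inj_on f (carrier G)"
    using bij by (simp add: bij_betw_def)
  then show ?thesis
    using G group_transport_group Metric_space_transport_metric transport_group_iso
    by (auto simp: isometric_group_iso_def isometric_group_iso_axioms_def transport_metric_def)
qed

end

section \<open>Transfer of all the properties\<close>

theorem theorem2p1:
  fixes G :: "('a, 'm) monoid_scheme" and \<rho> :: "'a \<Rightarrow> 'a \<Rightarrow> real"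
    and X :: "'b set" and f :: "'a \<Rightarrow> 'b"
  assumes "X \<approx> (UNIV :: real set)"
    and "polish_group G \<rho>"
    and "bij_betw f (carrier G) X"
  shows
    "(polish_group (transport_group G f X) (transport_metric G \<rho> f) \<and>
      borel_isomorphic (group_topology (transport_group G f X) (transport_metric G \<rho> f)) (group_topology G \<rho>))
   \<and> (polish_group G \<rho> \<and> comm_group G \<longrightarrow>
      polish_group (transport_group G f X) (transport_metric G \<rho> f) \<and> comm_group (transport_group G f X))
   \<and> (two_sided_invariant_metric G \<rho> \<longrightarrow>
      two_sided_invariant_metric (transport_group G f X) (transport_metric G \<rho> f))
   \<and> (dense_in_itself (group_topology G \<rho>) \<longrightarrow>
      dense_in_itself (group_topology (transport_group G f X) (transport_metric G \<rho> f)))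
   \<and> (polish_group G \<rho> \<and> compact_space (group_topology G \<rho>) \<longrightarrow>
      polish_group (transport_group G f X) (transport_metric G \<rho> f) \<and>
      compact_space (group_topology (transport_group G f X) (transport_metric G \<rho> f)))
   \<and> (polish_group G \<rho> \<and> locally_compact_space (group_topology G \<rho>) \<longrightarrow>
      polish_group (transport_group G f X) (transport_metric G \<rho> f) \<and>
      locally_compact_space (group_topology (transport_group G f X) (transport_metric G \<rho> f)))
   \<and> (polish_group G \<rho> \<and> \<not> locally_compact_space (group_topology G \<rho>) \<longrightarrow>
      polish_group (transport_group G f X) (transport_metric G \<rho> f) \<and>
      \<not> locally_compact_space (group_topology (transport_group G f X) (transport_metric G \<rho> f)))
   \<and> (polish_group G \<rho> \<and> (locally_compact_space (group_topology G \<rho>) \<or> compact_space (group_topology G \<rho>)) \<longrightarrow>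
      (\<forall>\<mu>.
        (left_haar_measure G \<rho> \<mu> \<longrightarrow>
          left_haar_measure (transport_group G f X) (transport_metric G \<rho> f) (transport_measure G \<rho> f X \<mu>)) \<and>
        (right_haar_measure G \<rho> \<mu> \<longrightarrow>
          right_haar_measure (transport_group G f X) (transport_metric G \<rho> f) (transport_measure G \<rho> f X \<mu>)) \<and>
        (two_sided_haar_measure G \<rho> \<mu> \<longrightarrow>
          two_sided_haar_measure (transport_group G f X) (transport_metric G \<rho> f) (transport_measure G \<rho> f X \<mu>))))
   \<and> (polish_group G \<rho> \<and> \<not> locally_compact_space (group_topology G \<rho>) \<longrightarrow>
      (\<forall>\<mu>.
        (borel_measure_on (group_topology G \<rho>) \<mu> \<and> quasi_finite \<mu> \<and> left_invariant G \<mu> \<longrightarrow>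
          borel_measure_on (group_topology (transport_group G f X) (transport_metric G \<rho> f)) (transport_measure G \<rho> f X \<mu>) \<and>
          quasi_finite (transport_measure G \<rho> f X \<mu>) \<and>
          left_invariant (transport_group G f X) (transport_measure G \<rho> f X \<mu>)) \<and>
        (borel_measure_on (group_topology G \<rho>) \<mu> \<and> quasi_finite \<mu> \<and> right_invariant G \<mu> \<longrightarrow>
          borel_measure_on (group_topology (transport_group G f X) (transport_metric G \<rho> f)) (transport_measure G \<rho> f X \<mu>) \<and>
          quasi_finite (transport_measure G \<rho> f X \<mu>) \<and>
          right_invariant (transport_group G f X) (transport_measure G \<rho> f X \<mu>)) \<and>
        (borel_measure_on (group_topology G \<rho>) \<mu> \<and> quasi_finite \<mu> \<and> two_sided_invariant G \<mu> \<longrightarrow>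
          borel_measure_on (group_topology (transport_group G f X) (transport_metric G \<rho> f)) (transport_measure G \<rho> f X \<mu>) \<and>
          quasi_finite (transport_measure G \<rho> f X \<mu>) \<and>
          two_sided_invariant (transport_group G f X) (transport_measure G \<rho> f X \<mu>))))"
proof -
  let ?H = "transport_group G f X" and ?\<sigma> = "transport_metric G \<rho> f"
  let ?S = "group_topology G \<rho>" and ?T = "group_topology ?H ?\<sigma>"
  interpret isometric_group_iso G \<rho> ?H ?\<sigma> f
    using assms isometric_group_iso_transport by blast
  note homeo = homeomorphic_map_group_topology
  have homeo_space: "?S homeomorphic_space ?T"
    using homeo homeomorphic_space by blast
  have polish: "polish_group ?H ?\<sigma>"
    using assms by (simp add: polish_group_image)
  have borel_iso: "borel_isomorphic ?T ?S"
    using homeo_space homeomorphic_space_sym homeomorphic_space_imp_borel_isomorphic by blast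
  have comm: "comm_group G \<Longrightarrow> comm_group ?H"
    using assms comm_group_transport_group by blast
  have dense: "dense_in_itself ?S \<Longrightarrow> dense_in_itself ?T"
    using homeo homeomorphic_map_dense_in_itself by blast
  have compact: "compact_space ?S \<longleftrightarrow> compact_space ?T"
    using homeo_space by (rule homeomorphic_compact_space)
  have loc_compact: "locally_compact_space ?S \<longleftrightarrow> locally_compact_space ?T"
    using homeo_space by (rule homeomorphic_locally_compact_space)
  have measure_transfer:
    "(haar_regular ?S \<mu> \<longrightarrow> haar_regular ?T (transport_measure G \<rho> f X \<mu>)) \<and>
     borel_measure_on ?T (transport_measure G \<rho> f X \<mu>) \<and>
     (quasi_finite \<mu> \<longrightarrow> quasi_finite (transport_measure G \<rho> f X \<mu>)) \<and>
     (left_invariant G \<mu> \<longrightarrow> left_invariant ?H (transport_measure G \<rho> f X \<mu>)) \<and>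
     (right_invariant G \<mu> \<longrightarrow> right_invariant ?H (transport_measure G \<rho> f X \<mu>)) \<and>
     (two_sided_invariant G \<mu> \<longrightarrow> two_sided_invariant ?H (transport_measure G \<rho> f X \<mu>))"
    if "borel_measure_on ?S \<mu>" for \<mu>
  proof -
    interpret group_pushforward G ?H ?S ?T f \<mu>
      using that by (rule group_pushforward)
    show ?thesis
      unfolding transport_measure_def
      by (intro conjI impI haar_regular_pushforward borel_measure_on_pushforward
          quasi_finite_pushforward left_invariant_pushforward right_invariant_pushforward
          two_sided_invariant_pushforward)
  qed
  have haar_borel: "haar_regular ?S \<mu> \<Longrightarrow> borel_measure_on ?S \<mu>" for \<mu>
    by (simp add: haar_regular_def)
  show ?thesis
    unfolding left_haar_measure_def right_haar_measure_def two_sided_haar_measure_def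
    by (simp add: polish borel_iso comm two_sided_invariant_metric_image dense
        compact[symmetric] loc_compact[symmetric] measure_transfer haar_borel)
qed

end
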